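(* Let $d,q,n$ be positive integers with $3\le q<d$ and $n\ge d+2$. Then any equivalent-structure learning algorithm for proper $q$-colorings and the family $\mathcal{G}(n,d)$ that succeeds with probability at least $1/2$ requires at least $\exp(\Omega(d-q))$ samples.
   Context: For a graph $G$, $\Omega_G$ is the set of proper $q$-colorings and $\pi_G$ the uniform distribution on $\Omega_G$. $\mathcal{G}(n,d)$ is the family of graphs on a fixed set of $n$ vertices with maximum degree at most $d$. An equivalent-structure learning algorithm for $\mathcal{G}(n,d)$ receives $L$ independent samples from $\pi_G$ for an unknown $q$-colorable $G\in\mathcal{G}(n,d)$ and outputs $G'\in\mathcal{G}(n,d)$; it succeeds with probability at least $p$ if $\Pr[\Omega_{G'}=\Omega_G]\ge p$ for every such $G$. *)

theory Defs
  imports "HOL-Probability.Probability"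
begin

text \<open>Simple graphs on the fixed vertex set \<open>{..<n}\<close> are represented by their edge sets,
  an edge being a two-element set of vertices; colors are \<open>{..<q}\<close>.\<close>

type_synonym ugraph = "nat set set"
type_synonym coloring = "nat \<Rightarrow> nat"

definition vdegree :: "ugraph \<Rightarrow> nat \<Rightarrow> nat" where
  "vdegree E v = card {e \<in> E. v \<in> e}"

definition simple_graphs :: "nat \<Rightarrow> ugraph set" where
  "simple_graphs n = {E. \<forall>e\<in>E. e \<subseteq> {..<n} \<and> card e = 2}"

definition bounded_degree_graphs :: "nat \<Rightarrow> nat \<Rightarrow> ugraph set" where
  "bounded_degree_graphs n d = {E \<in> simple_graphs n. \<forall>v<n. vdegree E v \<le> d}"

text \<open>Assignments are extensional functions, so that there are exactly \<open>q ^ n\<close> of them.\<close>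

definition assignments :: "nat \<Rightarrow> nat \<Rightarrow> coloring set" where
  "assignments n q = {..<n} \<rightarrow>\<^sub>E {..<q}"

definition proper_colorings :: "nat \<Rightarrow> nat \<Rightarrow> ugraph \<Rightarrow> coloring set" where
  "proper_colorings n q E =
     {\<sigma> \<in> assignments n q. \<forall>u v. {u, v} \<in> E \<longrightarrow> \<sigma> u \<noteq> \<sigma> v}"

definition colorable :: "nat \<Rightarrow> nat \<Rightarrow> ugraph \<Rightarrow> bool" where
  "colorable n q E \<longleftrightarrow> proper_colorings n q E \<noteq> {}"

text \<open>\<open>pmf_of_set\<close> is meaningful only for finite nonempty sets, that is, here, when the graph
  is \<open>q\<close>-colorable.\<close>

definition uniform_coloring :: "nat \<Rightarrow> nat \<Rightarrow> ugraph \<Rightarrow> coloring pmf" where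
  "uniform_coloring n q E = pmf_of_set (proper_colorings n q E)"

text \<open>A learning algorithm using \<open>L\<close> samples is a possibly randomized function from lists of
  \<open>L\<close> assignments to graphs of the family; a deterministic one has only values of the form
  \<open>return_pmf E\<close>. It may depend on \<open>n\<close>, \<open>d\<close>, \<open>q\<close> and \<open>L\<close>, but not on the unknown graph. No
  computability or running time constraint is imposed.\<close>

definition learning_algorithm ::
    "nat \<Rightarrow> nat \<Rightarrow> nat \<Rightarrow> nat \<Rightarrow> (coloring list \<Rightarrow> ugraph pmf) \<Rightarrow> bool" where
  "learning_algorithm n d q L A \<longleftrightarrow>
     (\<forall>xs. length xs = L \<and> set xs \<subseteq> assignments n q \<longrightarrow>
        set_pmf (A xs) \<subseteq> bounded_degree_graphs n d)"

text \<open>\<open>replicate_pmf L p\<close> is the distribution of a list of \<open>L\<close> independent samples from \<open>p\<close>;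
  the internal randomness of the algorithm is independent of the samples.\<close>

definition output_distribution ::
    "nat \<Rightarrow> nat \<Rightarrow> nat \<Rightarrow> (coloring list \<Rightarrow> ugraph pmf) \<Rightarrow> ugraph \<Rightarrow> ugraph pmf" where
  "output_distribution n q L A E =
     bind_pmf (replicate_pmf L (uniform_coloring n q E)) A"

definition learns_equivalent_structure ::
    "nat \<Rightarrow> nat \<Rightarrow> nat \<Rightarrow> nat \<Rightarrow> (coloring list \<Rightarrow> ugraph pmf) \<Rightarrow> real \<Rightarrow> bool" where
  "learns_equivalent_structure n d q L A p \<longleftrightarrow>
     learning_algorithm n d q L A \<and>
     (\<forall>E \<in> bounded_degree_graphs n d. colorable n q E \<longrightarrow>
        measure_pmf.prob (output_distribution n q L A E)
          {E'. proper_colorings n q E' = proper_colorings n q E} \<ge> p)"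

end

theory Submission
  imports Defs
begin

text \<open>Let \<open>t = d - q + 2\<close>. Join a clique \<open>C\<close> on \<open>q - 2\<close> vertices completely to an independent set
  \<open>W\<close> of \<open>t + 1\<close> vertices, so that \<open>W\<close> has only two colors available, and join one further vertex
  \<open>u\<close> to all of \<open>W\<close>, or to all of \<open>W\<close> but one vertex \<open>w\<close>. The \<open>t + 1\<close> graphs with an edge
  \<open>{u, w}\<close> missing have pairwise different colorings. A coloring
  violating the missing edge is constant on \<open>W - {w}\<close>; recoloring \<open>u\<close> with a color of \<open>C\<close> frees both
  colors for each of the \<open>t\<close> vertices of \<open>W - {w}\<close>, so the violation has probability at most
  \<open>1 / 2 ^ t\<close>. Hence, up to probability \<open>L / 2 ^ t\<close>, all of these graphs yield the same \<open>L\<close> samples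
  as the graph with all edges, and an algorithm succeeds on average with probability at most
  \<open>1 / (t + 1) + L / 2 ^ t\<close>. As \<open>t \<ge> 3\<close>, this forces \<open>L \<ge> 2 ^ (d - q)\<close>.\<close>

section \<open>Guessing one of several almost indistinguishable uniform distributions\<close>

lemma pmf_replicate_pmf:
  "pmf (replicate_pmf L p) xs = (if length xs = L then prod_list (map (pmf p) xs) else 0)"
proof (induction L arbitrary: xs)
  case 0
  then show ?case by (auto simp: indicator_def)
next
  case (Suc L)
  let ?c = "\<lambda>(x, xs). x # xs"
  have eq: "replicate_pmf (Suc L) p = map_pmf ?c (pair_pmf p (replicate_pmf L p))"
    by (simp add: pair_pmf_def map_bind_pmf)
  show ?case
  proof (cases xs)
    case Nil
    then show ?thesis by (simp add: pmf_eq_0_set_pmf set_replicate_pmf del: replicate_pmf.simps)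
  next
    case (Cons y ys)
    have "inj ?c" by (auto simp: inj_on_def)
    from pmf_map_inj'[OF this, of _ "(y, ys)"] show ?thesis
      unfolding eq Cons by (simp add: pmf_pair Suc)
  qed
qed

text \<open>Turns independent sampling into counting: success probabilities become averages over
  lists.\<close>

lemma replicate_pmf_of_set:
  assumes "finite A" "A \<noteq> {}"
  shows "replicate_pmf L (pmf_of_set A) = pmf_of_set {xs. set xs \<subseteq> A \<and> length xs = L}"
proof (rule pmf_eqI)
  fix xs :: "'a list"
  obtain a where "a \<in> A" using assms by blast
  then have "replicate L a \<in> {xs. set xs \<subseteq> A \<and> length xs = L}" by auto
  then have ne: "{xs. set xs \<subseteq> A \<and> length xs = L} \<noteq> {}" by blast
  have "prod_list (map (pmf (pmf_of_set A)) xs) =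
      (if set xs \<subseteq> A then 1 / real (card A) ^ length xs else 0)"
    using assms by (induction xs) (auto simp: indicator_def)
  then show "pmf (replicate_pmf L (pmf_of_set A)) xs =
      pmf (pmf_of_set {xs. set xs \<subseteq> A \<and> length xs = L}) xs"
    using assms ne
    by (auto simp: pmf_replicate_pmf finite_lists_length_eq card_lists_length_eq indicator_def)
qed

lemma measure_bind_pmf_of_set:
  assumes "finite A" "A \<noteq> {}"
  shows "measure_pmf.prob (pmf_of_set A \<bind> f) T = (\<Sum>x\<in>A. measure_pmf.prob (f x) T) / card A"
proof -
  have "ennreal (measure_pmf.prob (pmf_of_set A \<bind> f) T) =
      (\<integral>\<^sup>+x. ennreal (measure_pmf.prob (f x) T) \<partial>pmf_of_set A)"
    by (simp add: measure_pmf.emeasure_eq_measure[symmetric])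
  also have "\<dots> = ennreal (measure_pmf.expectation (pmf_of_set A) (\<lambda>x. measure_pmf.prob (f x) T))"
    by (intro nn_integral_eq_integral measure_pmf.integrable_const_bound[where B=1]) auto
  finally show ?thesis using assms
    by (simp add: integral_pmf_of_set sum_nonneg)
qed

text \<open>A list with all entries in the common core \<open>D\<close> can arise under every
  hypothesis, and on it the disjoint events \<open>T i\<close> share total probability at most 1;
  averaging over \<open>i\<close> gives the term \<open>1 / card I\<close>. Under hypothesis
  \<open>i\<close>, a list leaves \<open>D\<close> with probability at most
  \<open>1 - (1 - \<epsilon>) ^ L\<close>, which is at most \<open>L * \<epsilon>\<close>.\<close>

lemma multiple_hypothesis_testing_bound:
  fixes B :: "'i \<Rightarrow> 'a set" and A :: "'a list \<Rightarrow> 'b pmf" and \<epsilon> p :: real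
  assumes I: "finite I" "I \<noteq> {}"
    and disj: "disjoint_family_on T I"
    and B: "\<And>i. i \<in> I \<Longrightarrow> finite (B i)" "\<And>i. i \<in> I \<Longrightarrow> D \<subseteq> B i" and D: "D \<noteq> {}"
    and eps: "\<And>i. i \<in> I \<Longrightarrow> card (B i - D) \<le> \<epsilon> * card (B i)" "\<epsilon> \<le> 1"
    and p: "\<And>i. i \<in> I \<Longrightarrow>
      p \<le> measure_pmf.prob (replicate_pmf L (pmf_of_set (B i)) \<bind> A) (T i)"
  shows "p \<le> 1 / card I + L * \<epsilon>"
proof -
  define lists_of where "lists_of = (\<lambda>S::'a set. {xs. set xs \<subseteq> S \<and> length xs = L})"
  define f where "f = (\<lambda>i xs. measure_pmf.prob (A xs) (T i))"
  have f: "0 \<le> f i xs" "f i xs \<le> 1" for i xs by (auto simp: f_def)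
  have finD: "finite D" using B I finite_subset by (metis ex_in_conv)
  then have cD: "card D > 0" using D by (simp add: card_gt_0_iff)
  have fin_lists: "finite (lists_of S)" if "finite S" for S
    using that by (simp add: lists_of_def finite_lists_length_eq)
  have card_lists: "real (card (lists_of S)) = real (card S) ^ L" if "finite S" for S
    using that by (simp add: lists_of_def card_lists_length_eq)
  have single: "p \<le> (\<Sum>xs\<in>lists_of D. f i xs) / real (card D) ^ L + L * \<epsilon>" if i: "i \<in> I" for i
  proof -
    have cB: "0 < card D" "card D \<le> card (B i)"
      using B[OF i] cD by (auto intro: card_mono)
    have Bne: "B i \<noteq> {}" "lists_of (B i) \<noteq> {}"
      using cB fin_lists[OF B(1)[OF i]] card_lists[OF B(1)[OF i]] by auto
    have sub: "lists_of D \<subseteq> lists_of (B i)" using B[OF i] by (auto simp: lists_of_def)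
    have "(1 - \<epsilon>) * card (B i) \<le> card D"
      using eps(1)[OF i] B[OF i] card_Diff_subset[OF finD B(2)[OF i]] cB
      by (simp add: algebra_simps of_nat_diff)
    then have ratio: "1 - \<epsilon> \<le> card D / card (B i)"
      using cB by (simp add: field_simps)
    \<comment> \<open>Bernoulli's inequality and the monotonicity of the power below both rely on
      \<open>\<epsilon> \<le> 1\<close>.\<close>
    have "1 + real L * (- \<epsilon>) \<le> (1 + - \<epsilon>) ^ L"
      using eps(2) by (intro Bernoulli_inequality) simp
    also have "\<dots> \<le> (card D / card (B i)) ^ L"
      using ratio eps(2) by (intro power_mono) auto
    finally have pow: "1 - (card D / card (B i)) ^ L \<le> L * \<epsilon>" by simp
    have "p \<le> (\<Sum>xs\<in>lists_of (B i). f i xs) / real (card (B i)) ^ L"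
      using p[OF i] measure_bind_pmf_of_set[OF fin_lists[OF B(1)[OF i]] Bne(2), of A "T i"]
      unfolding replicate_pmf_of_set[OF B(1)[OF i] Bne(1)] card_lists[OF B(1)[OF i], symmetric]
      by (simp add: f_def lists_of_def)
    also have "(\<Sum>xs\<in>lists_of (B i). f i xs) =
        (\<Sum>xs\<in>lists_of D. f i xs) + (\<Sum>xs\<in>lists_of (B i) - lists_of D. f i xs)"
      using sum.subset_diff[OF sub fin_lists[OF B(1)[OF i]], of "f i"] by simp
    also have "(\<Sum>xs\<in>lists_of (B i) - lists_of D. f i xs) \<le> card (lists_of (B i) - lists_of D)"
      using sum_bounded_above[of "lists_of (B i) - lists_of D" "f i" 1] f by simp
    also have "real (card (lists_of (B i) - lists_of D)) = real (card (B i)) ^ L - real (card D) ^ L"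
      using card_Diff_subset[OF fin_lists[OF finD] sub] card_mono[OF fin_lists[OF B(1)[OF i]] sub]
      by (simp add: of_nat_diff card_lists B[OF i] finD)
    finally have "p \<le> ((\<Sum>xs\<in>lists_of D. f i xs) + (real (card (B i)) ^ L - real (card D) ^ L))
        / real (card (B i)) ^ L"
      by (simp add: divide_right_mono)
    also have "\<dots> = (\<Sum>xs\<in>lists_of D. f i xs) / real (card (B i)) ^ L
        + (1 - (card D / card (B i)) ^ L)"
      using cB by (simp add: field_simps power_divide)
    \<comment> \<open>Shrinking the denominator to \<open>card D\<close> loses little and makes it
      the same for all \<open>i\<close>, so that the sums can be swapped later.\<close>
    also have "\<dots> \<le> (\<Sum>xs\<in>lists_of D. f i xs) / real (card D) ^ L + L * \<epsilon>"
      using cB pow f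
      by (intro add_mono divide_left_mono power_mono sum_nonneg mult_pos_pos zero_less_power) auto
    finally show ?thesis .
  qed
  have "(\<Sum>i\<in>I. f i xs) \<le> 1" for xs
  proof -
    have "(\<Sum>i\<in>I. f i xs) = measure_pmf.prob (A xs) (\<Union>i\<in>I. T i)"
      unfolding f_def using I disj
      by (intro measure_pmf.finite_measure_finite_Union[symmetric]) auto
    then show ?thesis by simp
  qed
  then have "(\<Sum>xs\<in>lists_of D. \<Sum>i\<in>I. f i xs) \<le> (\<Sum>xs\<in>lists_of D. 1)"
    by (intro sum_mono)
  then have "(\<Sum>i\<in>I. \<Sum>xs\<in>lists_of D. f i xs) \<le> real (card D) ^ L"
    by (subst sum.swap) (simp add: card_lists finD)
  then have tot: "(\<Sum>i\<in>I. \<Sum>xs\<in>lists_of D. f i xs) / real (card D) ^ L \<le> 1"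
    using cD by simp
  have "card I * p = (\<Sum>i\<in>I. p)" by simp
  also have "\<dots> \<le> (\<Sum>i\<in>I. (\<Sum>xs\<in>lists_of D. f i xs) / real (card D) ^ L + L * \<epsilon>)"
    by (intro sum_mono single)
  also have "\<dots> = (\<Sum>i\<in>I. \<Sum>xs\<in>lists_of D. f i xs) / real (card D) ^ L + card I * (L * \<epsilon>)"
    by (simp add: sum.distrib sum_divide_distrib)
  also have "\<dots> \<le> 1 + card I * (L * \<epsilon>)" using tot by simp
  finally have "card I * p \<le> 1 + card I * (L * \<epsilon>)" .
  moreover have "card I > 0" using I by (simp add: card_gt_0_iff)
  ultimately show ?thesis by (simp add: field_simps)
qed

section \<open>The hard family of graphs\<close>

text \<open>Here \<open>C = {..<q-2}\<close>, \<open>u = q - 2\<close> and \<open>W = {q-1..d+1}\<close>; the vertex \<open>u\<close> is joined to \<open>X\<close>.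
  The vertices from \<open>d + 2\<close> on are isolated.\<close>

definition hard_graph :: "nat \<Rightarrow> nat \<Rightarrow> nat set \<Rightarrow> ugraph" where
  "hard_graph d q X =
     {{a, b} | a b. a < q - 2 \<and> b < q - 2 \<and> a \<noteq> b} \<union>
     {{a, w} | a w. a < q - 2 \<and> w \<in> {q-1..d+1}} \<union>
     {{q - 2, w} | w. w \<in> X}"

lemma vdegree_le_card:
  assumes "finite N" "\<And>x. {v, x} \<in> E \<Longrightarrow> x \<in> N" "\<forall>e\<in>E. card e = 2"
  shows "vdegree E v \<le> card N"
proof -
  have "{e \<in> E. v \<in> e} \<subseteq> (\<lambda>x. {v, x}) ` N"
  proof
    fix e assume e: "e \<in> {e \<in> E. v \<in> e}"
    then obtain a b where "e = {a, b}" using assms(3) by (auto simp: card_2_iff)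
    with e obtain x where "e = {v, x}" by auto
    with e assms(2) show "e \<in> (\<lambda>x. {v, x}) ` N" by auto
  qed
  then have "vdegree E v \<le> card ((\<lambda>x. {v, x}) ` N)"
    unfolding vdegree_def using assms(1) by (intro card_mono) auto
  also have "\<dots> \<le> card N" using assms(1) by (rule card_image_le)
  finally show ?thesis .
qed

lemma edge_hard_graph_iff:
  assumes "X \<subseteq> {q-1..d+1}" "3 \<le> q"
  shows "{x, y} \<in> hard_graph d q X \<longleftrightarrow>
    x < q - 2 \<and> y < q - 2 \<and> x \<noteq> y \<or>
    x < q - 2 \<and> y \<in> {q-1..d+1} \<or> y < q - 2 \<and> x \<in> {q-1..d+1} \<or>
    x = q - 2 \<and> y \<in> X \<or> y = q - 2 \<and> x \<in> X"
  unfolding hard_graph_def by (auto simp: doubleton_eq_iff)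

text \<open>A vertex of \<open>C\<close> is joined to all of the first \<open>d + 2\<close> vertices
  except itself and \<open>u\<close>, which is exactly \<open>d\<close>. The vertex \<open>u\<close>
  has at most \<open>d - q + 3\<close> neighbors, at most \<open>d\<close> since
  \<open>q \<ge> 3\<close>, and every vertex of \<open>W\<close> at most
  \<open>q - 1\<close>.\<close>

lemma hard_graph_bounded_degree:
  assumes X: "X \<subseteq> {q-1..d+1}" and q: "3 \<le> q" "q < d" "d + 2 \<le> n"
  shows "hard_graph d q X \<in> bounded_degree_graphs n d"
proof -
  \<comment> \<open>Excludes a loop at \<open>u\<close>, which would be an edge of cardinality
    1.\<close>
  have "q - 2 \<notin> X" using subsetD[OF X, of "q - 2"] q by auto
  then have two: "e \<subseteq> {..<n} \<and> card e = 2" if "e \<in> hard_graph d q X" for e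
    using that unfolding hard_graph_def
    by (elim UnE CollectE exE conjE) (use X q in \<open>auto simp: card_insert_if\<close>)
  have "vdegree (hard_graph d q X) v \<le> d" for v
  proof -
    consider "v < q - 2" | "v = q - 2" | "v \<ge> q - 1" by linarith
    then obtain N where N: "finite N" "\<And>x. {v, x} \<in> hard_graph d q X \<Longrightarrow> x \<in> N" "card N \<le> d"
    proof cases
      case 1
      show ?thesis
      proof (rule that[of "{..<d+2} - {v, q - 2}"])
        show "card ({..<d+2} - {v, q - 2}) \<le> d"
          using 1 q by (subst card_Diff_subset) auto
      next
        fix x assume "{v, x} \<in> hard_graph d q X"
        then show "x \<in> {..<d+2} - {v, q - 2}"
          using subsetD[OF X, of v] X q 1 by (auto simp: edge_hard_graph_iff)
      qed simp
    next
      case 2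
      show ?thesis
        by (rule that[of "{q-1..d+1}"]) (use X q 2 in \<open>auto simp: edge_hard_graph_iff\<close>)
    next
      case 3
      show ?thesis
        by (rule that[of "{..<q-1}"]) (use X q 3 in \<open>auto simp: edge_hard_graph_iff\<close>)
    qed
    from vdegree_le_card[OF N(1,2)] two N(3) show ?thesis by (meson le_trans)
  qed
  with two show ?thesis by (auto simp: bounded_degree_graphs_def simple_graphs_def)
qed

lemma proper_colorings_hard_graph_iff:
  assumes "X \<subseteq> {q-1..d+1}" "3 \<le> q"
  shows "\<sigma> \<in> proper_colorings n q (hard_graph d q X) \<longleftrightarrow>
    \<sigma> \<in> assignments n q \<and> inj_on \<sigma> {..<q-2} \<and>
    (\<forall>a<q-2. \<forall>w\<in>{q-1..d+1}. \<sigma> w \<noteq> \<sigma> a) \<and> (\<forall>w\<in>X. \<sigma> w \<noteq> \<sigma> (q - 2))"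
proof -
  define W where "W = {q-1..d+1}"
  show ?thesis
    unfolding proper_colorings_def mem_Collect_eq edge_hard_graph_iff[OF assms] W_def[symmetric]
    by (auto simp: inj_on_def) metis+
qed

lemma finite_proper_colorings: "finite (proper_colorings n q E)"
  by (rule finite_subset[of _ "assignments n q"])
    (auto simp: proper_colorings_def assignments_def intro: finite_PiE)

text \<open>The power of 2 comes from an injection \<open>g\<close> of pairs of a violating coloring
  and a subset of \<open>W - {w}\<close> into \<open>D\<close>. It can be inverted because a
  violating coloring is determined by its values outside \<open>u\<close> and
  \<open>W - {w}\<close>, which \<open>g\<close> leaves alone.\<close>

lemma card_violating_colorings:
  assumes w: "w \<in> {q-1..d+1}" and q: "3 \<le> q" "q < d" "d + 2 \<le> n"
  defines "W \<equiv> {q-1..d+1}"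
  defines "D \<equiv> proper_colorings n q (hard_graph d q W)"
    and "B \<equiv> proper_colorings n q (hard_graph d q (W - {w}))"
  shows "card (B - D) * 2 ^ (d - q + 2) \<le> card D"
proof -
  \<comment> \<open>The set \<open>S\<close> marks the vertices switched to the color of
    \<open>w\<close>. Vertex 0 lies in \<open>C\<close> as \<open>q \<ge> 3\<close>, so its color is
    absent from \<open>W\<close> and safe for \<open>u\<close>.\<close>
  define g where "g = (\<lambda>(\<sigma>, S). \<lambda>v::nat.
    if v = q - 2 then \<sigma> (0::nat) else if v \<in> S then \<sigma> w else (\<sigma> v :: nat))"
  have D_iff: "\<sigma> \<in> D \<longleftrightarrow> \<sigma> \<in> assignments n q \<and> inj_on \<sigma> {..<q-2} \<and>
    (\<forall>a<q-2. \<forall>w\<in>W. \<sigma> w \<noteq> \<sigma> a) \<and> (\<forall>v\<in>W. \<sigma> v \<noteq> \<sigma> (q - 2))" for \<sigma>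
    unfolding D_def W_def using q by (intro proper_colorings_hard_graph_iff) auto
  have B_iff: "\<sigma> \<in> B \<longleftrightarrow> \<sigma> \<in> assignments n q \<and> inj_on \<sigma> {..<q-2} \<and>
    (\<forall>a<q-2. \<forall>w\<in>W. \<sigma> w \<noteq> \<sigma> a) \<and> (\<forall>v\<in>W - {w}. \<sigma> v \<noteq> \<sigma> (q - 2))" for \<sigma>
    unfolding B_def W_def using q by (intro proper_colorings_hard_graph_iff) auto
  have wW: "w \<in> W" using w by (simp add: W_def)
  have u: "\<sigma> (q - 2) = \<sigma> w" if "\<sigma> \<in> B - D" for \<sigma>
    using that wW unfolding Diff_iff B_iff D_iff by (metis DiffI singletonD)
  have ne: "\<sigma> v \<noteq> \<sigma> w" if "\<sigma> \<in> B - D" "v \<in> W - {w}" for \<sigma> v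
    using u[OF that(1)] that by (auto simp: B_iff)
  have range: "\<sigma> v < q" if "\<sigma> \<in> assignments n q" "v < n" for \<sigma> v
    using that by (auto simp: assignments_def PiE_def Pi_def)
  \<comment> \<open>\<open>C\<close> takes \<open>q - 2\<close> colors and \<open>w\<close> another
    one; \<open>u\<close> shares the color of \<open>w\<close>, so a single color is left for each
    vertex of \<open>W - {w}\<close>.\<close>
  have forced: "{\<sigma> v} = {..<q} - \<sigma> ` {..<q-2} - {\<sigma> w}"
    if s: "\<sigma> \<in> B - D" and v: "v \<in> W - {w}" for \<sigma> v
  proof (rule card_seteq)
    have \<sigma>: "\<sigma> \<in> assignments n q" using s by (simp add: B_iff)
    have "w < n" "v < n" using wW v q by (auto simp: W_def)
    then have "\<sigma> w < q" and vq: "\<sigma> v < q" using range[OF \<sigma>] by blast+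
    then have "\<sigma> w \<in> {..<q} - \<sigma> ` {..<q-2}" using s wW by (auto simp: B_iff)
    moreover have "\<sigma> ` {..<q-2} \<subseteq> {..<q}" using range[OF \<sigma>] q by fastforce
    moreover have "card (\<sigma> ` {..<q-2}) = q - 2"
      using s by (auto simp: B_iff card_image)
    ultimately show "card ({..<q} - \<sigma> ` {..<q-2} - {\<sigma> w}) \<le> card {\<sigma> v}"
      using q by (simp add: card_Diff_subset)
    show "{\<sigma> v} \<subseteq> {..<q} - \<sigma> ` {..<q-2} - {\<sigma> w}"
      using ne[OF s v] s v vq by (auto simp: B_iff)
  qed simp
  have cardW: "card (Pow (W - {w})) = 2 ^ (d - q + 2)"
  proof -
    have "card (W - {w}) = d - q + 2" using wW q by (simp add: W_def)
    then show ?thesis by (simp add: card_Pow W_def)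
  qed
  have "card ((B - D) \<times> Pow (W - {w})) \<le> card D"
  proof (rule card_inj_on_le[of g])
    show "finite D" unfolding D_def by (rule finite_proper_colorings)
    show "g ` ((B - D) \<times> Pow (W - {w})) \<subseteq> D"
    proof safe
      fix \<sigma> S assume s: "\<sigma> \<in> B" "\<sigma> \<notin> D" and S: "S \<subseteq> W - {w}"
      have C: "g (\<sigma>, S) a = \<sigma> a" if "a < q - 2" for a
        using that subsetD[OF S, of a] by (auto simp: g_def W_def)
      have W: "g (\<sigma>, S) v \<in> {\<sigma> v, \<sigma> w}" if "v \<in> W" for v
        using that q by (auto simp: g_def W_def)
      have U: "g (\<sigma>, S) (q - 2) = \<sigma> 0" by (simp add: g_def)
      have "g (\<sigma>, S) \<in> assignments n q"
        unfolding assignments_def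
      proof (rule PiE_I)
        have \<sigma>: "\<sigma> \<in> assignments n q" using s(1) by (simp add: B_iff)
        fix v
        have "w < n" "0 < n" using wW q by (auto simp: W_def)
        then show "g (\<sigma>, S) v \<in> {..<q}" if "v \<in> {..<n}"
          using that range[OF \<sigma>] by (auto simp: g_def)
        show "g (\<sigma>, S) v = undefined" if v: "v \<notin> {..<n}"
        proof -
          have "v \<notin> S" "v \<noteq> q - 2" using subsetD[OF S, of v] v q by (auto simp: W_def)
          moreover have "\<sigma> v = undefined"
            using \<sigma> v unfolding assignments_def by (rule PiE_arb)
          ultimately show ?thesis by (simp add: g_def)
        qed
      qed
      moreover have "inj_on (g (\<sigma>, S)) {..<q-2}"
        using s(1) C by (auto simp: B_iff inj_on_def)
      moreover have "g (\<sigma>, S) v \<noteq> \<sigma> a" if "v \<in> W" "a < q - 2" for v a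
        using W[OF that(1)] that s(1) wW by (auto simp: B_iff)
      moreover have "0 < q - 2" using q by simp
      ultimately show "g (\<sigma>, S) \<in> D" unfolding D_iff using C U by auto
    qed
    show "inj_on g ((B - D) \<times> Pow (W - {w}))"
    proof (rule inj_onI, clarify)
      fix \<sigma> S \<tau> S'
      assume s: "\<sigma> \<in> B" "\<sigma> \<notin> D" "S \<subseteq> W - {w}" and t: "\<tau> \<in> B" "\<tau> \<notin> D" "S' \<subseteq> W - {w}"
        and eq: "g (\<sigma>, S) = g (\<tau>, S')"
      have off: "\<sigma> v = \<tau> v" if "v \<noteq> q - 2" "v \<notin> W - {w}" for v
        using fun_cong[OF eq, of v] subsetD[OF s(3), of v] subsetD[OF t(3), of v] that
        by (auto simp: g_def split: if_splits)
      have ww: "\<sigma> w = \<tau> w" by (rule off) (use wW q in \<open>auto simp: W_def\<close>)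
      have "\<sigma> a = \<tau> a" if "a < q - 2" for a by (rule off) (use that in \<open>auto simp: W_def\<close>)
      then have im: "\<sigma> ` {..<q-2} = \<tau> ` {..<q-2}" by (auto intro!: image_cong)
      have on: "\<sigma> v = \<tau> v" if "v \<in> W - {w}" for v
        using forced[of \<sigma> v] forced[of \<tau> v] s t that im ww by auto
      have "\<sigma> = \<tau>"
      proof
        fix v show "\<sigma> v = \<tau> v"
          using off[of v] on[of v] u[of \<sigma>] u[of \<tau>] s t ww by (cases "v = q - 2") auto
      qed
      \<comment> \<open>By \<open>ne\<close>, the color of \<open>w\<close> is new on
        \<open>W - {w}\<close>, so it appears there exactly on \<open>S\<close>.\<close>
      moreover have "v \<in> S \<longleftrightarrow> v \<in> S'" if v: "v \<in> W - {w}" for v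
      proof -
        have "v \<noteq> q - 2" using v q by (auto simp: W_def)
        then show ?thesis
          using fun_cong[OF eq, of v] ne[of \<sigma> v] ne[of \<tau> v] s t v ww
          by (auto simp: g_def split: if_splits)
      qed
      ultimately show "\<sigma> = \<tau> \<and> S = S'" using s(3) t(3) by blast
    qed
  qed
  then show ?thesis by (simp add: card_cartesian_product cardW)
qed

text \<open>One coloring serves all \<open>X\<close> at once: it is proper when the edge from
  \<open>u\<close> to \<open>w\<close> is missing and improper when another edge at \<open>u\<close>
  is missing instead. This gives both colorability and distinctness of the family.\<close>

lemma hard_graph_separating_coloring:
  assumes w: "w \<in> {q-1..d+1}" and q: "3 \<le> q" "q < d" "d + 2 \<le> n"
  shows "\<exists>\<sigma>. \<forall>X \<subseteq> {q-1..d+1}. \<sigma> \<in> proper_colorings n q (hard_graph d q X) \<longleftrightarrow> w \<notin> X"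
proof -
  \<comment> \<open>\<open>C\<close> and \<open>u\<close> use the colors up to \<open>q - 2\<close>;
    \<open>w\<close> repeats the color of \<open>u\<close>, and the rest of \<open>W\<close> gets
    the last color, so the only possible conflict is between \<open>u\<close> and
    \<open>w\<close>.\<close>
  define \<sigma> where "\<sigma> = (\<lambda>v\<in>{..<n}. if v \<le> q - 2 then v else if v = w then q - 2 else q - 1)"
  have "\<sigma> \<in> assignments n q" using q by (auto simp: \<sigma>_def assignments_def)
  moreover have "inj_on \<sigma> {..<q-2}" using q by (auto simp: \<sigma>_def inj_on_def)
  moreover have "\<sigma> v \<noteq> \<sigma> a" if "a < q - 2" "v \<in> {q-1..d+1}" for a v
    using that q by (auto simp: \<sigma>_def)
  moreover have "\<sigma> v = \<sigma> (q - 2) \<longleftrightarrow> v = w" if "v \<in> {q-1..d+1}" for v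
    using that q w by (auto simp: \<sigma>_def)
  ultimately have "\<sigma> \<in> proper_colorings n q (hard_graph d q X) \<longleftrightarrow> w \<notin> X"
    if X: "X \<subseteq> {q-1..d+1}" for X
    unfolding proper_colorings_hard_graph_iff[OF X q(1)] using X w by (metis subsetD)
  then show ?thesis by blast
qed

theorem theorem8:
  shows "\<exists>c::real. c > 0 \<and>
    (\<forall>(d::nat) (q::nat) (n::nat) (L::nat) (A :: coloring list \<Rightarrow> ugraph pmf).
       3 \<le> q \<and> q < d \<and> d + 2 \<le> n \<and> learns_equivalent_structure n d q L A (1/2) \<longrightarrow>
       real L \<ge> exp (c * (real d - real q)))"
proof (intro exI[of _ "ln 2"] conjI allI impI)
  fix d q n L :: nat and A :: "coloring list \<Rightarrow> ugraph pmf"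
  assume "3 \<le> q \<and> q < d \<and> d + 2 \<le> n \<and> learns_equivalent_structure n d q L A (1/2)"
  then have q: "3 \<le> q" "q < d" "d + 2 \<le> n"
    and learns: "learns_equivalent_structure n d q L A (1/2)" by auto
  define W where "W = {q-1..d+1}"
  define B where "B = (\<lambda>w. proper_colorings n q (hard_graph d q (W - {w})))"
  define D where "D = proper_colorings n q (hard_graph d q W)"
  have sub: "D \<subseteq> B w" for w
    unfolding D_def B_def W_def
    using q by (auto simp: proper_colorings_hard_graph_iff)
  have sep: "\<exists>\<sigma>. \<sigma> \<in> B w \<and> (\<forall>v\<in>W. v \<noteq> w \<longrightarrow> \<sigma> \<notin> B v)" if w: "w \<in> W" for w
  proof -
    obtain \<sigma> where \<sigma>: "\<And>X. X \<subseteq> W \<Longrightarrow> \<sigma> \<in> proper_colorings n q (hard_graph d q X) \<longleftrightarrow> w \<notin> X"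
      using hard_graph_separating_coloring[OF w[unfolded W_def] q] unfolding W_def by metis
    show ?thesis unfolding B_def by (rule exI[of _ \<sigma>]) (use \<sigma> w in auto)
  qed
  have "q - 1 \<in> W" using q by (simp add: W_def)
  have few: "card (B w - D) * 2 ^ (d - q + 2) \<le> card D" if "w \<in> W" for w
    using card_violating_colorings[of w q d n] that q unfolding B_def D_def W_def by blast
  have few': "card (B w - D) \<le> 1 / 2 ^ (d - q + 2) * real (card (B w))" if "w \<in> W" for w
  proof -
    have "card (B w - D) * 2 ^ (d - q + 2) \<le> card (B w)"
      using few[OF that] card_mono[OF _ sub[of w]] finite_proper_colorings
      unfolding B_def by (meson le_trans)
    then have "real (card (B w - D) * 2 ^ (d - q + 2)) \<le> real (card (B w))" by linarith
    then show ?thesis by (simp add: field_simps)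
  qed
  \<comment> \<open>No coloring of the full graph has to be exhibited: an empty \<open>D\<close>
    would, by \<open>few\<close>, leave \<open>B (q - 1)\<close> empty, against
    \<open>sep\<close>.\<close>
  have "D \<noteq> {}"
  proof
    assume "D = {}"
    then have "card (B (q - 1)) = 0" using few[OF \<open>q - 1 \<in> W\<close>] by simp
    then show False
      using sep[OF \<open>q - 1 \<in> W\<close>] finite_proper_colorings unfolding B_def by auto
  qed
  have "1/2 \<le> 1 / card W + L * (1 / 2 ^ (d - q + 2))"
  proof (rule multiple_hypothesis_testing_bound[of W "\<lambda>w. {E'. proper_colorings n q E' = B w}" B D _ _ L A])
    show "finite W" "W \<noteq> {}" using \<open>q - 1 \<in> W\<close> by (auto simp: W_def)
    show "disjoint_family_on (\<lambda>w. {E'. proper_colorings n q E' = B w}) W"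
      using sep unfolding disjoint_family_on_def by fastforce
  next
    fix w assume w: "w \<in> W"
    show "finite (B w)" unfolding B_def by (rule finite_proper_colorings)
    have "hard_graph d q (W - {w}) \<in> bounded_degree_graphs n d"
      unfolding W_def using q by (intro hard_graph_bounded_degree) auto
    moreover have "colorable n q (hard_graph d q (W - {w}))"
      using sep[OF w] unfolding colorable_def B_def by blast
    ultimately show "1/2 \<le> measure_pmf.prob (replicate_pmf L (pmf_of_set (B w)) \<bind> A)
        {E'. proper_colorings n q E' = B w}"
      using learns
      unfolding learns_equivalent_structure_def output_distribution_def uniform_coloring_def B_def
      by blast
  next
    show "1 / 2 ^ (d - q + 2) \<le> (1 :: real)" by (intro divide_le_eq_1_pos[THEN iffD2] one_le_power) simp_all
  qed (use sub few' \<open>D \<noteq> {}\<close> in blast)+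
  \<comment> \<open>Here \<open>card W = d - q + 3\<close> and \<open>q < d\<close>. Guessing thus
    accounts for at most 1/4, and the other 1/4 cancels the factor \<open>2 ^ 2\<close> in
    \<open>2 ^ (d - q + 2)\<close>.\<close>
  moreover have "card W \<ge> 4" using q by (simp add: W_def)
  then have "1 / real (card W) \<le> 1 / 4" by (simp add: field_simps)
  ultimately have "1/4 \<le> L * (1 / 2 ^ (d - q + 2))" by linarith
  then have "2 ^ (d - q) \<le> real L" by (simp add: field_simps power_add)
  moreover have "exp (ln 2 * (real d - real q)) = 2 ^ (d - q)"
    using q powr_realpow[of 2 "d - q"] by (simp add: powr_def of_nat_diff mult.commute)
  ultimately show "exp (ln 2 * (real d - real q)) \<le> real L" by simp
qed simp

end
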